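(* Let $K$ be a convex body in $\mathbb{R}^{d}$. Then for every $t$ with $0 < t \leq \frac{1}{4}e^{-4}\, \mathrm{vol}_{d}(K)$ there are $n \in \mathbb{N}$ with $$ n \leq e^{16d}\ \frac{\mathrm{vol}_{d}(K \setminus K_{t})}{t\ \mathrm{vol}_{d}(B_{2}^{d})} $$ and a polytope $P_{n}$ that has $n$ vertices and satisfies $$ K_{t} \subset P_{n} \subset K . $$
   Context: A convex body in $\mathbb{R}^d$ is a compact convex set with nonempty interior; $\mathrm{vol}_d$ is $d$-dimensional volume (Lebesgue measure); $B_2^d$ is the closed Euclidean unit ball of $\mathbb{R}^d$. A polytope is the convex hull of finitely many points. For a convex body $K$ and $t>0$, the (convex) floating body $K_{t}$ of $K$ is the intersection of all closed halfspaces whose defining hyperplanes cut off a set of volume $t$ from $K$; that is, the intersection of all closed halfspaces $H^{+}$, bounded by a hyperplane $H$, such that the opposite closed halfspace $H^{-}$ bounded by $H$ satisfies $\mathrm{vol}_d(K\cap H^{-})=t$. *)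

theory Defs
  imports "HOL-Analysis.Analysis"
begin

abbreviation vol :: "'a::euclidean_space set \<Rightarrow> real" where
  "vol A \<equiv> measure lebesgue A"

definition convex_body :: "'a::euclidean_space set \<Rightarrow> bool" where
  "convex_body K \<longleftrightarrow> compact K \<and> convex K \<and> interior K \<noteq> {}"

definition floating_body :: "'a::euclidean_space set \<Rightarrow> real \<Rightarrow> 'a set" where
  "floating_body K t =
     \<Inter> {{x. u \<bullet> x \<le> b} | u b. u \<noteq> 0 \<and> vol (K \<inter> {x. u \<bullet> x \<ge> b}) = t}"

definition vertices :: "'a::euclidean_space set \<Rightarrow> 'a set" where
  "vertices P = {v. v extreme_point_of P}"

end

theory Submission
  imports Defs "HOL-Probability.Distribution_Functions"
begin

text \<open>
  For \<open>y\<close> in the floating body \<open>K\<^sub>t\<close>, a hyperplane separating \<open>y\<close> strictly from a set \<open>X\<close> bounds a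
  halfspace that contains \<open>y\<close> and misses \<open>X\<close>. As \<open>y\<close> is not cut off by the parallel cap of
  volume \<open>t\<close>, that halfspace contains the cap, which therefore misses \<open>X\<close> as well. Hence a finite \<open>X \<subseteq> K\<close> that meets every cap of volume \<open>t\<close> satisfies \<open>K\<^sub>t \<subseteq> conv X \<subseteq> K\<close>, and the
  task is to find such a hitting set of size at most \<open>12\<^sup>d vol (K - K\<^sub>t) / t\<close>.

  To this end every cap \<open>C\<close> of volume \<open>t\<close> is given a point \<open>z\<close> whose distance from the bounding
  hyperplane is at least half the height of \<open>C\<close>, and around \<open>z\<close> the part
  \<open>M\<close> of \<open>K\<close> that is symmetric about \<open>z\<close>, shrunk by the factor \<open>1/3\<close>.  The following three facts
  carry the proof.  The point can be chosen so that \<open>M\<close> has volume at least \<open>t / 12\<^sup>d\<close>, by averaging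
  over the upper half of the cap (\<open>cap_has_deep_point\<close>).  The set \<open>M\<close> lies in the open
  cap, hence in \<open>K - K\<^sub>t\<close> (\<open>macbeath_region_in_open_cap\<close>).  If the sets \<open>M\<close> of \<open>z\<close> and of another point
  \<open>y\<close> meet, then \<open>y\<close> lies in the cap for which \<open>z\<close> was chosen (\<open>macbeath_regions_meet\<close>).  So the
  points of a maximal family with pairwise disjoint sets \<open>M\<close> hit all caps of volume \<open>t\<close>, and comparing
  volumes bounds their number.  Finally \<open>12\<^sup>d\<close> is absorbed by \<open>exp (16 d) / vol B\<close>, because the unit
  ball lies in a cube of side 2.
\<close>

section \<open>Caps of prescribed volume\<close>

lemma vol_hyperplane_section:
  assumes "u \<noteq> (0::'a::euclidean_space)"
  shows "vol (K \<inter> {x. u \<bullet> x = b}) = 0"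
proof -
  have "negligible (K \<inter> {x. u \<bullet> x = b})"
    using negligible_hyperplane[of u b] assms by (meson inf_le2 negligible_subset)
  then show ?thesis
    by (simp add: negligible_imp_measure0)
qed

text \<open>
  The volume cut off is a distribution function of the linear form on \<open>K\<close>. It has no atoms since
  hyperplanes are null sets, so the intermediate value theorem applies.
\<close>

lemma cap_of_volume_exists:
  fixes K :: "'a::euclidean_space set"
  assumes K: "compact K" and u: "u \<noteq> 0" and t: "0 < t" "t < vol K"
  shows "\<exists>b. vol (K \<inter> {x. u \<bullet> x \<ge> b}) = t"
proof -
  define M where "M = distr (restrict_space lborel K) borel (\<lambda>x. - (u \<bullet> x))"
  have Kb: "K \<in> sets borel"
    using K by (simp add: borel_compact)
  have meas: "(\<lambda>x. - (u \<bullet> x)) \<in> restrict_space lborel K \<rightarrow>\<^sub>M borel"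
    by (intro measurable_restrict_space1) simp
  have fin: "finite_measure (restrict_space lborel K)"
    using Kb emeasure_compact_finite[OF K] by (intro finite_measureI)
      (simp add: emeasure_restrict_space space_restrict_space less_top)
  interpret finite_borel_measure M
    unfolding M_def finite_borel_measure_def finite_borel_measure_axioms_def
    using finite_measure.finite_measure_distr[OF fin meas] by simp
  have M_eq: "measure M A = vol (K \<inter> {x. - (u \<bullet> x) \<in> A})" if "A \<in> sets borel" for A
  proof -
    have eq: "(\<lambda>x. - (u \<bullet> x)) -` A \<inter> space (restrict_space lborel K) = K \<inter> {x. - (u \<bullet> x) \<in> A}"
      by (auto simp: space_restrict_space)
    have S: "K \<inter> {x. - (u \<bullet> x) \<in> A} \<in> sets borel"
      using that Kb by measurable
    show ?thesis
      unfolding M_def measure_distr[OF meas that] eq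
      using S Kb by (simp add: measure_restrict_space measure_completion)
  qed
  have cont: "isCont (cdf M) r" for r
  proof -
    have "K \<inter> {x. - (u \<bullet> x) \<in> {r}} = K \<inter> {x. u \<bullet> x = - r}"
      by auto
    then show ?thesis
      using vol_hyperplane_section[OF u, of K "- r"] M_eq[of "{r}"] by (simp add: isCont_cdf)
  qed
  obtain B where B: "\<And>x. x \<in> K \<Longrightarrow> \<bar>u \<bullet> x\<bar> \<le> B"
  proof -
    have "compact ((\<lambda>x. u \<bullet> x) ` K)"
      using K by (intro compact_continuous_image continuous_intros)
    then obtain B where "\<forall>y\<in>(\<lambda>x. u \<bullet> x) ` K. norm y \<le> B"
      using compact_imp_bounded bounded_iff by metis
    then show ?thesis
      by (intro that[of B]) simp
  qed
  have "K \<inter> {x. - (u \<bullet> x) \<in> {..- \<bar>B\<bar> - 1}} = {}"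
    using B by fastforce
  then have low: "cdf M (- \<bar>B\<bar> - 1) = 0"
    unfolding cdf_def using M_eq[of "{..- \<bar>B\<bar> - 1}"] by simp
  have "K \<inter> {x. - (u \<bullet> x) \<in> {..\<bar>B\<bar>}} = K"
    using B by fastforce
  then have high: "cdf M \<bar>B\<bar> = vol K"
    unfolding cdf_def using M_eq[of "{..\<bar>B\<bar>}"] by simp
  have "\<exists>r. - \<bar>B\<bar> - 1 \<le> r \<and> r \<le> \<bar>B\<bar> \<and> cdf M r = t"
    using low high t cont by (intro IVT) auto
  then obtain r where "cdf M r = t"
    by blast
  moreover have "K \<inter> {x. - (u \<bullet> x) \<in> {..r}} = K \<inter> {x. u \<bullet> x \<ge> - r}"
    by auto
  ultimately have "vol (K \<inter> {x. u \<bullet> x \<ge> - r}) = t"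
    unfolding cdf_def using M_eq[of "{..r}"] by simp
  then show ?thesis ..
qed

section \<open>Macbeath regions\<close>

abbreviation symmetric_part :: "'a::euclidean_space set \<Rightarrow> 'a \<Rightarrow> 'a set" where
  "symmetric_part C z \<equiv> {v. z + v \<in> C \<and> z - v \<in> C}"

lemma compact_symmetric_part:
  assumes "compact C"
  shows "compact (symmetric_part C z)"
proof -
  have "symmetric_part C z = (\<lambda>x. x - z) ` C \<inter> (\<lambda>x. z - x) ` C"
  proof (intro subset_antisym subsetI)
    fix v assume "v \<in> symmetric_part C z"
    then show "v \<in> (\<lambda>x. x - z) ` C \<inter> (\<lambda>x. z - x) ` C"
      by (auto intro: image_eqI[where x = "z + v"] image_eqI[where x = "z - v"])
  next
    fix v assume "v \<in> (\<lambda>x. x - z) ` C \<inter> (\<lambda>x. z - x) ` C"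
    then obtain x y where xy: "x \<in> C" "y \<in> C" "v = x - z" "v = z - y"
      by auto
    have "z + v = x"
      using xy(3) by simp
    moreover have "z - v = y"
      using xy(4) by simp
    ultimately show "v \<in> symmetric_part C z"
      using xy by simp
  qed
  moreover have "compact ((\<lambda>x. x - z) ` C)" "compact ((\<lambda>x. z - x) ` C)"
    using assms by (auto intro!: compact_continuous_image continuous_intros)
  ultimately show ?thesis
    by (simp add: compact_Int)
qed

text \<open>
  Exchanging the order of integration,
  \<open>\<integral> vol (C \<inter> (2z - C)) dz = \<integral>\<^sub>C vol ((x + C) / 2) dx = 2\<^sup>-\<^sup>d (vol C)\<^sup>2\<close>. By convexity the integrand on
  the left vanishes for \<open>z\<close> outside \<open>C\<close>, so its mean over \<open>C\<close> is \<open>2\<^sup>-\<^sup>d vol C\<close>. The set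
  \<open>C \<inter> (2z - C)\<close> is the translate by \<open>z\<close> of the symmetric part at \<open>z\<close>.
\<close>

lemma large_symmetric_part_exists:
  fixes C :: "'a::euclidean_space set"
  assumes C: "compact C" "convex C" and pos: "0 < vol C"
  shows "\<exists>z\<in>C. vol C / 2 ^ DIM('a) \<le> vol (symmetric_part C z)"
proof (rule ccontr)
  assume "\<not> ?thesis"
  then have small: "vol (symmetric_part C z) < vol C / 2 ^ DIM('a)" if "z \<in> C" for z
    using that by force
  let ?c = "ennreal (vol C / 2 ^ DIM('a))"
  define T where "T z = {x. x \<in> C \<and> 2 *\<^sub>R z - x \<in> C}" for z
  have Cb [measurable]: "C \<in> sets borel"
    using C by (simp add: borel_compact)
  have eC: "emeasure lborel C = ennreal (vol C)"
    using C by (metis Cb emeasure_compact_finite emeasure_eq_ennreal_measure infinity_ennreal_def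
        measure_completion order_less_irrefl sets_lborel top.extremum_strict)
  have T_shift: "T z = (\<lambda>v. 1 *\<^sub>R v + z) ` symmetric_part C z" for z
    unfolding T_def by (auto simp: algebra_simps scaleR_2 intro!: image_eqI[where x = "x - z" for x])
  have T_compact: "compact (T z)" for z
    unfolding T_shift using compact_symmetric_part[OF C(1)]
    by (intro compact_continuous_image continuous_intros)
  have eT: "emeasure lborel (T z) = ennreal (vol (symmetric_part C z))" for z
  proof -
    have "vol (T z) = vol (symmetric_part C z)"
      unfolding T_shift by (simp only: measure_lebesgue_affine) simp
    moreover have "emeasure lebesgue (T z) = ennreal (vol (T z))"
      using T_compact[of z] by (simp add: emeasure_eq_measure2 lmeasurable_compact)
    moreover have "emeasure lebesgue (T z) = emeasure lborel (T z)"
      using T_compact[of z] by (simp add: borel_compact)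
    ultimately show ?thesis
      by simp
  qed
  have T_outside: "T z = {}" if "z \<notin> C" for z
  proof (rule ccontr)
    assume "T z \<noteq> {}"
    then obtain x where "x \<in> C" "2 *\<^sub>R z - x \<in> C"
      unfolding T_def by auto
    then have "(1/2) *\<^sub>R x + (1/2) *\<^sub>R (2 *\<^sub>R z - x) \<in> C"
      using C by (intro convexD) auto
    moreover have "(1/2) *\<^sub>R x + (1/2) *\<^sub>R (2 *\<^sub>R z - x) = z"
      by (simp add: algebra_simps)
    ultimately show False
      using that by simp
  qed
  define g :: "'a \<Rightarrow> 'a \<Rightarrow> ennreal"
    where "g x z = indicator C x * indicator C (2 *\<^sub>R z - x)" for x z
  have g_meas: "case_prod g \<in> borel_measurable (lborel \<Otimes>\<^sub>M lborel)"
    unfolding g_def by measurable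
  have inner_x: "(\<integral>\<^sup>+x. g x z \<partial>lborel) = emeasure lborel (T z)" for z
  proof -
    have "(\<lambda>x. g x z) = indicator (T z)"
      by (auto simp: g_def T_def indicator_def fun_eq_iff)
    then show ?thesis
      using T_compact[of z] by (simp add: borel_compact)
  qed
  have inner_z: "(\<integral>\<^sup>+z. g x z \<partial>lborel) = indicator C x * ?c" for x
  proof -
    have eq: "{z. 2 *\<^sub>R z - x \<in> C} = (\<lambda>y. (1/2) *\<^sub>R y + (1/2) *\<^sub>R x) ` C"
      by (auto simp: algebra_simps simp flip: scaleR_add_left
          intro!: image_eqI[where x = "2 *\<^sub>R z - x" for z])
    have b: "{z. 2 *\<^sub>R z - x \<in> C} \<in> sets borel"
      by measurable
    have "emeasure lborel {z. 2 *\<^sub>R z - x \<in> C} = emeasure lebesgue {z. 2 *\<^sub>R z - x \<in> C}"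
      using b by simp
    also have "\<dots> = ennreal ((1/2) ^ DIM('a)) * emeasure lebesgue C"
      unfolding eq by (simp only: emeasure_lebesgue_affine) simp
    also have "\<dots> = ennreal ((1/2) ^ DIM('a)) * ennreal (vol C)"
      using eC by simp
    also have "\<dots> = ?c"
      by (simp add: ennreal_mult'[symmetric] power_divide)
    finally have "emeasure lborel {z. 2 *\<^sub>R z - x \<in> C} = ?c" .
    moreover have "(\<lambda>z. g x z) = (\<lambda>z. indicator C x * indicator {z. 2 *\<^sub>R z - x \<in> C} z)"
      by (auto simp: g_def indicator_def fun_eq_iff)
    ultimately show ?thesis
      using b by (simp add: nn_integral_cmult)
  qed
  have T_meas: "(\<lambda>z. emeasure lborel (T z)) \<in> borel_measurable lborel"
    unfolding inner_x[symmetric] using g_meas by measurable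
  have total: "(\<integral>\<^sup>+z. emeasure lborel (T z) \<partial>lborel) = (\<integral>\<^sup>+z. indicator C z * ?c \<partial>lborel)"
    using lborel_pair.Fubini'[OF g_meas] by (simp add: inner_x inner_z)
  have "(\<integral>\<^sup>+z. emeasure lborel (T z) \<partial>lborel) < (\<integral>\<^sup>+z. indicator C z * ?c \<partial>lborel)"
  proof (rule nn_integral_less)
    show "(\<integral>\<^sup>+z. emeasure lborel (T z) \<partial>lborel) \<noteq> \<infinity>"
      unfolding total by (simp add: nn_integral_multc eC ennreal_mult_eq_top_iff)
    have "emeasure lborel (T z) \<le> indicator C z * ?c" for z
      using small[of z] T_outside[of z]
      by (cases "z \<in> C") (auto simp: eT intro!: ennreal_leI)
    then show "AE z in lborel. emeasure lborel (T z) \<le> indicator C z * ?c"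
      by simp
    show "\<not> (AE z in lborel. indicator C z * ?c \<le> emeasure lborel (T z))"
    proof
      assume "AE z in lborel. indicator C z * ?c \<le> emeasure lborel (T z)"
      then have "AE z in lborel. z \<notin> C"
      proof eventually_elim
        case (elim z)
        then show ?case
          using small[of z] by (auto simp: eT ennreal_le_iff)
      qed
      then have "emeasure lborel C = 0"
        using AE_iff_measurable[of C lborel "\<lambda>z. z \<notin> C"] by simp
      then show False
        using eC pos by simp
    qed
  qed (use T_meas in auto)
  then show False
    using total by simp
qed

text \<open>
  The factor \<open>1/3\<close> is the largest one for which \<open>macbeath_regions_meet\<close> below holds with depth at
  least half the height of the cap.
\<close>

definition macbeath_region :: "'a::euclidean_space set \<Rightarrow> 'a \<Rightarrow> 'a set" where
  "macbeath_region K z = (\<lambda>v. (1/3) *\<^sub>R v + z) ` symmetric_part K z"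

lemma compact_macbeath_region: "compact K \<Longrightarrow> compact (macbeath_region K z)"
  unfolding macbeath_region_def
  by (intro compact_continuous_image continuous_intros compact_symmetric_part)

lemma vol_macbeath_region:
  "vol (macbeath_region K (z::'a::euclidean_space)) = vol (symmetric_part K z) / 3 ^ DIM('a)"
  unfolding macbeath_region_def
  by (simp only: measure_lebesgue_affine) (simp add: power_divide)

lemma center_in_macbeath_region: "z \<in> K \<Longrightarrow> z \<in> macbeath_region K z"
  unfolding macbeath_region_def by (auto intro!: image_eqI[where x = 0])

lemma macbeath_region_subset:
  assumes "convex K"
  shows "macbeath_region K z \<subseteq> K"
proof
  fix x assume "x \<in> macbeath_region K z"
  then obtain v where v: "z + v \<in> K" "z - v \<in> K" "x = (1/3) *\<^sub>R v + z"
    unfolding macbeath_region_def by auto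
  then have "(2/3) *\<^sub>R (z + v) + (1/3) *\<^sub>R (z - v) \<in> K"
    using assms by (intro convexD) auto
  moreover have "(2/3) *\<^sub>R (z + v) + (1/3) *\<^sub>R (z - v) = x"
  proof -
    have "(2/3) *\<^sub>R (z + v) + (1/3) *\<^sub>R (z - v) = (2/3 + 1/3) *\<^sub>R z + (2/3 - 1/3) *\<^sub>R v"
      by (simp only: scaleR_add_right scaleR_diff_right scaleR_add_left scaleR_diff_left) simp
    then show ?thesis
      using v(3) by simp
  qed
  ultimately show "x \<in> K"
    by simp
qed

section \<open>Deep points of caps\<close>

definition deep_in_cap :: "'a::euclidean_space set \<Rightarrow> 'a \<Rightarrow> real \<Rightarrow> 'a \<Rightarrow> bool" where
  "deep_in_cap K u b z \<longleftrightarrow>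
     z \<in> K \<and> b < u \<bullet> z \<and> (\<forall>x\<in>K. u \<bullet> x - b \<le> 2 * (u \<bullet> z - b))"

text \<open>
  The point \<open>z + v\<close> is at most twice as high above the bounding hyperplane as \<open>z\<close>, so by symmetry a
  point of the symmetric part is nowhere lower than the hyperplane, and shrinking makes this strict.
\<close>

lemma macbeath_region_in_open_cap:
  assumes z: "deep_in_cap K u b z" and x: "x \<in> macbeath_region K z"
  shows "b < u \<bullet> x"
proof -
  obtain v where v: "z + v \<in> K" "z - v \<in> K" "x = (1/3) *\<^sub>R v + z"
    using x unfolding macbeath_region_def by auto
  have "u \<bullet> (z - v) - b \<le> 2 * (u \<bullet> z - b)"
    using z v(2) unfolding deep_in_cap_def by blast
  moreover have "b < u \<bullet> z"
    using z unfolding deep_in_cap_def by blast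
  ultimately show ?thesis
    unfolding v(3) by (simp add: inner_add_right inner_diff_right)
qed

text \<open>
  Measure heights above the bounding hyperplane and let \<open>h\<close> be that of \<open>z\<close> and \<open>p\<close> that of \<open>y\<close>. A
  common point \<open>y + v/3 = z + w/3\<close> has height at least \<open>2h/3\<close>, seen from \<open>z\<close>, and height at most
  \<open>p + (2h - p)/3\<close>, seen from \<open>y\<close>, since \<open>y + v \<in> K\<close> has height at most \<open>2h\<close>. Hence \<open>p \<ge> 0\<close>.
\<close>

lemma macbeath_regions_meet:
  assumes z: "deep_in_cap K u b z"
    and meet: "macbeath_region K y \<inter> macbeath_region K z \<noteq> {}"
  shows "b \<le> u \<bullet> y"
proof -
  obtain v w where v: "y + v \<in> K" and w: "z - w \<in> K"
    and eq: "(1/3) *\<^sub>R v + y = (1/3) *\<^sub>R w + z"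
    using meet unfolding macbeath_region_def by auto
  have "u \<bullet> (y + v) - b \<le> 2 * (u \<bullet> z - b)" "u \<bullet> (z - w) - b \<le> 2 * (u \<bullet> z - b)"
    using z v w unfolding deep_in_cap_def by blast+
  moreover have "(1/3) * (u \<bullet> v) + u \<bullet> y = (1/3) * (u \<bullet> w) + u \<bullet> z"
    using arg_cong[OF eq, of "\<lambda>x. u \<bullet> x"] by (simp add: inner_add_right)
  ultimately show ?thesis
    by (simp add: inner_add_right inner_diff_right)
qed

text \<open>
  The upper half of the cap contains the copy of the cap shrunk by \<open>1/2\<close> towards a highest point, so
  it has volume at least \<open>t / 2\<^sup>d\<close>. A point with large symmetric part in this half is deep enough, and
  its symmetric part in \<open>K\<close> can only be larger.
\<close>

lemma cap_has_deep_point: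
  fixes K :: "'a::euclidean_space set"
  assumes K: "compact K" "convex K" and u: "u \<noteq> 0"
    and t: "vol (K \<inter> {x. u \<bullet> x \<ge> b}) = t" "0 < t"
  shows "\<exists>z. deep_in_cap K u b z \<and> t / 12 ^ DIM('a) \<le> vol (macbeath_region K z)"
proof -
  let ?cap = "K \<inter> {x. u \<bullet> x \<ge> b}"
  have "K \<noteq> {}"
    using t by auto
  moreover have "continuous_on K (\<lambda>x. u \<bullet> x)"
    by (intro continuous_intros)
  ultimately have "\<exists>p\<in>K. \<forall>x\<in>K. u \<bullet> x \<le> u \<bullet> p"
    using K(1) by (intro continuous_attains_sup)
  then obtain p where p: "p \<in> K" "\<And>x. x \<in> K \<Longrightarrow> u \<bullet> x \<le> u \<bullet> p"
    by blast
  have above: "b < u \<bullet> p"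
  proof (rule ccontr)
    assume "\<not> b < u \<bullet> p"
    then have "?cap = K \<inter> {x. u \<bullet> x = b}"
      using p by force
    then show False
      using vol_hyperplane_section[OF u, of K b] t by simp
  qed
  define D where "D = K \<inter> {x. u \<bullet> x \<ge> (b + u \<bullet> p) / 2}"
  have D: "compact D" "convex D"
    unfolding D_def using K
    by (simp_all only: compact_Int_closed convex_Int closed_halfspace_ge convex_halfspace_ge)
  have shrunk: "(\<lambda>x. (1/2) *\<^sub>R x + (1/2) *\<^sub>R p) ` ?cap \<subseteq> D"
    unfolding D_def using K(2) p(1) by (auto simp: inner_add_right intro!: convexD)
  have cap: "compact ?cap"
    using K by (intro compact_Int_closed closed_halfspace_ge)
  have "t / 2 ^ DIM('a) = vol ((\<lambda>x. (1/2) *\<^sub>R x + (1/2) *\<^sub>R p) ` ?cap)"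
    by (simp only: measure_lebesgue_affine t) (simp add: power_divide)
  also have "\<dots> \<le> vol D"
    using shrunk D cap
    by (intro measure_mono_fmeasurable) (auto intro!: fmeasurableD lmeasurable_compact
        compact_continuous_image continuous_intros)
  finally have volD: "t / 2 ^ DIM('a) \<le> vol D" .
  moreover have "0 < t / 2 ^ DIM('a)"
    using t by simp
  ultimately have "0 < vol D"
    by linarith
  then obtain z where z: "z \<in> D" "vol D / 2 ^ DIM('a) \<le> vol (symmetric_part D z)"
    using large_symmetric_part_exists[OF D] by blast
  have "vol (symmetric_part D z) \<le> vol (symmetric_part K z)"
    using D(1) K(1)
    by (intro measure_mono_fmeasurable fmeasurableD lmeasurable_compact compact_symmetric_part)
      (auto simp: D_def)
  moreover have "t / 4 ^ DIM('a) \<le> vol D / 2 ^ DIM('a)"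
  proof -
    have "(4::real) ^ DIM('a) = 2 ^ DIM('a) * 2 ^ DIM('a)"
      by (simp flip: power_mult_distrib)
    then have "t / 4 ^ DIM('a) = t / 2 ^ DIM('a) / 2 ^ DIM('a)"
      by simp
    also have "\<dots> \<le> vol D / 2 ^ DIM('a)"
      using volD by (rule divide_right_mono) simp
    finally show ?thesis .
  qed
  ultimately have "t / 4 ^ DIM('a) \<le> vol (symmetric_part K z)"
    using z(2) by linarith
  then have "t / 4 ^ DIM('a) / 3 ^ DIM('a) \<le> vol (macbeath_region K z)"
    unfolding vol_macbeath_region by (rule divide_right_mono) simp
  then have "t / 12 ^ DIM('a) \<le> vol (macbeath_region K z)"
    by (simp flip: power_mult_distrib)
  moreover have "deep_in_cap K u b z"
    unfolding deep_in_cap_def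
  proof (intro conjI ballI)
    show "z \<in> K" "b < u \<bullet> z"
      using z(1) above by (auto simp: D_def)
    show "u \<bullet> x - b \<le> 2 * (u \<bullet> z - b)" if "x \<in> K" for x
      using z(1) p(2)[OF that] by (auto simp: D_def)
  qed
  ultimately show ?thesis
    by blast
qed

section \<open>A small set that hits all caps\<close>

lemma closed_floating_body: "closed (floating_body K t)"
  unfolding floating_body_def by (auto intro!: closed_Inter closed_halfspace_le)

lemma disjoint_sets_card_bound:
  assumes "finite X" and S: "S \<in> lmeasurable"
    and R: "\<And>x. x \<in> X \<Longrightarrow> R x \<in> lmeasurable" "\<And>x. x \<in> X \<Longrightarrow> R x \<subseteq> S"
      "\<And>x. x \<in> X \<Longrightarrow> e \<le> vol (R x)"
    and disj: "pairwise (\<lambda>x y. disjnt (R x) (R y)) X"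
  shows "real (card X) * e \<le> vol S"
proof -
  have "real (card X) * e \<le> (\<Sum>x\<in>X. vol (R x))"
    using R(3) sum_mono[of X "\<lambda>_. e" "\<lambda>x. vol (R x)"] by simp
  also have "\<dots> = vol (\<Union>x\<in>X. R x)"
    using assms by (intro measure_UNION'[symmetric]) auto
  also have "\<dots> \<le> vol S"
    using assms by (intro measure_mono_fmeasurable) (auto intro!: sets.finite_UN dest: fmeasurableD)
  finally show ?thesis .
qed

text \<open>
  The volume comparison bounds the cardinality of all packings by disjoint Macbeath regions of
  deep points, so there is a packing of largest cardinality. Its centres hit every cap, because the
  region chosen for a cap that they missed could be added.
\<close>

lemma hitting_set_exists:
  fixes K :: "'a::euclidean_space set"
  assumes K: "compact K" "convex K" and t: "0 < t"
  shows "\<exists>X. finite X \<and> X \<subseteq> K \<and>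
    real (card X) * (t / 12 ^ DIM('a)) \<le> vol (K - floating_body K t) \<and>
    (\<forall>u b. u \<noteq> 0 \<longrightarrow> vol (K \<inter> {x. u \<bullet> x \<ge> b}) = t \<longrightarrow> (\<exists>x\<in>X. b \<le> u \<bullet> x))"
proof -
  let ?R = "macbeath_region K" and ?e = "t / 12 ^ DIM('a)"
  define A where "A = {z. ?e \<le> vol (?R z) \<and>
    (\<exists>u b. u \<noteq> 0 \<and> vol (K \<inter> {x. u \<bullet> x \<ge> b}) = t \<and> deep_in_cap K u b z)}"
  define packing where
    "packing X \<longleftrightarrow> finite X \<and> X \<subseteq> A \<and> pairwise (\<lambda>x y. disjnt (?R x) (?R y)) X" for X
  have AK: "A \<subseteq> K"
    unfolding A_def deep_in_cap_def by auto
  have R_sub: "?R z \<subseteq> K - floating_body K t" if zA: "z \<in> A" for z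
  proof
    fix x assume x: "x \<in> ?R z"
    obtain u b where u: "u \<noteq> 0" "vol (K \<inter> {x. u \<bullet> x \<ge> b}) = t" "deep_in_cap K u b z"
      using zA unfolding A_def by blast
    have "\<not> u \<bullet> x \<le> b"
      using macbeath_region_in_open_cap[OF u(3) x] by simp
    then have "x \<notin> floating_body K t"
      unfolding floating_body_def using u by blast
    then show "x \<in> K - floating_body K t"
      using x macbeath_region_subset[OF K(2)] by blast
  qed
  have meas: "K - floating_body K t \<in> lmeasurable"
    using K borel_closed[OF closed_floating_body[of K t]]
    by (intro fmeasurable_Diff lmeasurable_compact) simp_all
  have bound: "real (card X) * ?e \<le> vol (K - floating_body K t)" if X: "packing X" for X
  proof (rule disjoint_sets_card_bound[where R = "?R"])
    fix x assume "x \<in> X"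
    then have "x \<in> A"
      using X unfolding packing_def by blast
    then show "?R x \<subseteq> K - floating_body K t" "?e \<le> vol (?R x)"
      using R_sub by (auto simp: A_def)
    show "?R x \<in> lmeasurable"
      using K by (simp add: compact_macbeath_region lmeasurable_compact)
  qed (use X meas in \<open>auto simp: packing_def\<close>)
  define N where "N = vol (K - floating_body K t) / ?e"
  have e: "0 < ?e"
    using t by simp
  have "card X < Suc (nat \<lfloor>N\<rfloor>)" if "packing X" for X
  proof -
    have "real (card X) \<le> N"
      using bound[OF that] e unfolding N_def by (simp only: pos_le_divide_eq)
    then show ?thesis
      by (simp add: le_nat_floor less_Suc_eq_le)
  qed
  moreover have "packing {}"
    unfolding packing_def by simp
  ultimately obtain X where X: "packing X" and maximal: "\<And>Y. packing Y \<Longrightarrow> card Y \<le> card X"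
    using ex_has_greatest_nat[of packing "{}" card] by blast
  have "\<exists>x\<in>X. b \<le> u \<bullet> x" if u: "u \<noteq> 0" and cap: "vol (K \<inter> {x. u \<bullet> x \<ge> b}) = t" for u b
  proof -
    obtain z where z: "deep_in_cap K u b z" "?e \<le> vol (?R z)"
      using cap_has_deep_point[OF K u cap t] by blast
    have zA: "z \<in> A"
      unfolding A_def using z u cap by blast
    have "\<exists>x\<in>X. ?R x \<inter> ?R z \<noteq> {}"
    proof (rule ccontr)
      assume none: "\<not> (\<exists>x\<in>X. ?R x \<inter> ?R z \<noteq> {})"
      moreover have "z \<in> ?R z"
        using zA AK center_in_macbeath_region by blast
      ultimately have "z \<notin> X"
        by blast
      have "packing (insert z X)"
        using X zA none unfolding packing_def by (auto simp: pairwise_insert disjnt_def)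
      from maximal[OF this] show False
        using X \<open>z \<notin> X\<close> by (simp add: packing_def)
    qed
    then show ?thesis
      using macbeath_regions_meet[OF z(1)] by blast
  qed
  then show ?thesis
    using X AK bound[OF X] unfolding packing_def by blast
qed

lemma floating_body_subset_convex_hull:
  fixes K :: "'a::euclidean_space set"
  assumes K: "compact K" and t: "0 < t" "t < vol K" and X: "finite X"
    and hits: "\<And>u b. u \<noteq> 0 \<Longrightarrow> vol (K \<inter> {x. u \<bullet> x \<ge> b}) = t \<Longrightarrow> \<exists>x\<in>X. b \<le> u \<bullet> x"
  shows "floating_body K t \<subseteq> convex hull X"
proof (rule subsetI, rule ccontr)
  fix y assume y: "y \<in> floating_body K t" and out: "y \<notin> convex hull X"
  (* Separating y from the empty set would allow a zero normal vector, which bounds no cap. *)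
  have "X \<noteq> {}"
  proof -
    obtain i :: 'a where "i \<in> Basis"
      using nonempty_Basis by blast
    then have "i \<noteq> 0"
      by (rule nonzero_Basis)
    then show ?thesis
      using cap_of_volume_exists[OF K _ t] hits by blast
  qed
  obtain a c where a: "a \<bullet> y < c" "\<And>x. x \<in> convex hull X \<Longrightarrow> c < a \<bullet> x"
    using separating_hyperplane_closed_point[of "convex hull X" y] out X
    by (auto simp: finite_imp_compact compact_convex_hull compact_imp_closed)
  have ax: "a \<bullet> y < a \<bullet> x" if "x \<in> X" for x
    using a that hull_inc[of x X convex] by fastforce
  have "a \<noteq> 0"
    using ax \<open>X \<noteq> {}\<close> by auto
  then have u: "- a \<noteq> 0"
    by simp
  obtain b where b: "vol (K \<inter> {x. - a \<bullet> x \<ge> b}) = t"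
    using cap_of_volume_exists[OF K u t] by blast
  have "- a \<bullet> y \<le> b"
    using y u b unfolding floating_body_def by blast
  moreover obtain x where "x \<in> X" "b \<le> - a \<bullet> x"
    using hits[OF u b] by blast
  ultimately show False
    using ax[of x] by simp
qed

section \<open>Approximation of the floating body\<close>

lemma vol_unit_ball_bounds:
  "0 < vol (cball (0::'a::euclidean_space) 1)" "vol (cball (0::'a) 1) \<le> 2 ^ DIM('a)"
proof -
  show "0 < vol (cball (0::'a) 1)"
    by (simp add: content_cball measure_completion)
  have "cball (0::'a) 1 \<subseteq> cbox (- One) One"
  proof
    fix x :: 'a assume "x \<in> cball 0 1"
    then have "\<bar>x \<bullet> i\<bar> \<le> 1" if "i \<in> Basis" for i
      using Basis_le_norm[OF that, of x] by simp
    then show "x \<in> cbox (- One) One"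
      by (auto simp: mem_box abs_le_iff)
  qed
  then have "vol (cball (0::'a) 1) \<le> vol (cbox (- One) (One::'a))"
    by (intro measure_mono_fmeasurable) (auto intro: fmeasurableD)
  also have "\<dots> = 2 ^ DIM('a)"
    by (simp add: content_cbox_if box_eq_empty measure_completion)
  finally show "vol (cball (0::'a) 1) \<le> 2 ^ DIM('a)" .
qed

theorem theorem2p1:
  fixes K :: "'a::euclidean_space set" and t :: real
  assumes "convex_body K"
    and "0 < t" and "t \<le> 1 / 4 * exp (-4) * vol K"
  shows "\<exists>n::nat.
    real n \<le> exp (16 * real DIM('a)) * (vol (K - floating_body K t) / (t * vol (cball (0::'a) 1))) \<and>
    (\<exists>P. polytope P \<and> card (vertices P) = n \<and> floating_body K t \<subseteq> P \<and> P \<subseteq> K)"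
proof -
  have K: "compact K" "convex K"
    using assms(1) by (auto simp: convex_body_def)
  let ?V = "vol (K - floating_body K t)" and ?B = "vol (cball (0::'a) 1)"
  have "0 < vol K"
  proof -
    have "0 < (1 / 4 * exp (-4)) * vol K"
      using assms(2,3) by linarith
    then show ?thesis
      by (simp add: zero_less_mult_iff)
  qed
  moreover have "1 / 4 * exp (-4) < (1::real)"
  proof -
    have "exp (-4) < (1::real)"
      by simp
    then show ?thesis
      by linarith
  qed
  ultimately have "1 / 4 * exp (-4) * vol K < 1 * vol K"
    by (intro mult_strict_right_mono)
  then have t: "t < vol K"
    using assms(3) by simp
  obtain X where X: "finite X" "X \<subseteq> K" "real (card X) * (t / 12 ^ DIM('a)) \<le> ?V"
    and hits: "\<And>u b. u \<noteq> 0 \<Longrightarrow> vol (K \<inter> {x. u \<bullet> x \<ge> b}) = t \<Longrightarrow> \<exists>x\<in>X. b \<le> u \<bullet> x"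
    using hitting_set_exists[OF K assms(2)] by metis
  define P where "P = convex hull X"
  have P: "polytope P" "P \<subseteq> K"
    unfolding P_def using X(1,2) K(2) by (auto simp: polytope_def intro: hull_minimal[THEN subsetD])
  have "floating_body K t \<subseteq> P"
    unfolding P_def by (rule floating_body_subset_convex_hull[OF K(1) assms(2) t X(1) hits])
  moreover have "real (card (vertices P)) \<le> exp (16 * real DIM('a)) * (?V / (t * ?B))"
  proof -
    have "vertices P \<subseteq> X"
      unfolding vertices_def P_def using extreme_point_of_convex_hull by blast
    then have "real (card (vertices P)) \<le> real (card X)"
      using X(1) by (simp add: card_mono)
    also have "\<dots> \<le> 12 ^ DIM('a) * (?V / t)"
      using X(3) assms(2) by (simp add: field_simps)
    also have "\<dots> \<le> (exp (16 * real DIM('a)) / ?B) * (?V / t)"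
    proof (rule mult_right_mono)
      have "12 ^ DIM('a) * ?B \<le> 12 ^ DIM('a) * 2 ^ DIM('a)"
        using vol_unit_ball_bounds(2) by (intro mult_left_mono) auto
      also have "\<dots> = (24::real) ^ DIM('a)"
        by (simp flip: power_mult_distrib)
      also have "\<dots> \<le> (exp 16) ^ DIM('a)"
      proof (rule power_mono)
        have "(24::real) \<le> 2 ^ 16"
          by simp
        also have "\<dots> \<le> exp 1 ^ 16"
          using exp_ge_add_one_self[of 1] by (intro power_mono) auto
        also have "\<dots> = exp (16::real)"
          by (simp flip: exp_of_nat_mult)
        finally show "24 \<le> exp (16::real)" .
      qed simp
      also have "\<dots> = exp (16 * real DIM('a))"
        by (simp add: exp_of_nat_mult[symmetric] mult.commute)
      finally show "12 ^ DIM('a) \<le> exp (16 * real DIM('a)) / ?B"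
        using vol_unit_ball_bounds(1)[where 'a='a] by (simp add: pos_le_divide_eq)
      show "0 \<le> ?V / t"
        using assms(2) by simp
    qed
    finally show ?thesis
      by (simp add: field_simps)
  qed
  ultimately show ?thesis
    using P by blast
qed

end
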